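(* Let $A$ be a commutative associative algebra over a field $\mathbf{k}$, let $D_1,\ldots,D_n$ be finitely many derivations of $A$, and let $\mathfrak{g}$ be the Lie subalgebra of $\mathrm{Der}(A)$ generated by $D_1,\ldots,D_n$. Suppose that $\mathfrak{g}$ is finite-dimensional. Then every derived operation $\{-,-\}$ on $A$ defined using $D_1,\ldots,D_n$ satisfies a standard identity: there exists $d>0$ such that $$s_{d,l}^{\{-,-\}}(a_1,\ldots,a_d)=s_{d,r}^{\{-,-\}}(a_1,\ldots,a_d)=0$$ for all $a_1,\ldots,a_d\in A$. In fact, if $\dim\mathfrak{g}\ge 1$, one can take $d=1+\binom{\dim\mathfrak{g}+p}{\dim\mathfrak{g}}$ for any integer $p> m\left(1+\frac{1}{\dim\mathfrak{g}}\right)$, where $m$ is the $\mathfrak{g}$-order of $\{-,-\}$.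
   Context: The universal enveloping algebra $U(\mathfrak{g})$ acts on $A$ by linear operators (a product of elements of $\mathfrak g$ acts as the composition of the corresponding derivations, and $1$ acts as the identity). Derived operation: a bilinear operation on $A$ of the form $$\{a,b\}:=\sum_{j=1}^s f_j(a)\, g_j(b),$$ where $f_1,g_1,\ldots,f_s,g_s$ are linear combinations of iterations of the derivations $D_1,\ldots,D_n$ (the empty iteration, i.e. the identity map, is allowed), regarded as given elements of $U(\mathfrak g)$. $\mathfrak{g}$-order: let $F^\bullet U(\mathfrak{g})$ be the standard filtration of $U(\mathfrak g)$, determined by $F^0U(\mathfrak{g})=\mathbf{k}1$, $F^1U(\mathfrak{g})=\mathbf{k}1\oplus\mathfrak{g}$, $F^kU(\mathfrak{g})\,F^lU(\mathfrak{g})\subset F^{k+l}U(\mathfrak{g})$; that is, $F^kU(\mathfrak g)$ is the span of all products of at most $k$ elements of $\mathfrak{g}$. If the derived operation is given by the formula above with $f_j\in F^{n_j}U(\mathfrak{g})$ and $g_j\in F^{m_j}U(\mathfrak{g})$, its $\mathfrak{g}$-order is $\max_j(n_j+m_j)$. Standard polynomials: for a bilinear operation $\{-,-\}$ on $A$, $$s_{d,l}^{\{-,-\}}(a_1,\ldots,a_d):=\sum_{\sigma\in S_{d-1}}(-1)^{\sigma}\{a_{\sigma(1)},\{a_{\sigma(2)},\{\ldots,\{a_{\sigma(d-2)},\{a_{\sigma(d-1)},a_d\}\}\ldots\}\}\},$$ $$s_{d,r}^{\{-,-\}}(a_1,\ldots,a_d):=\sum_{\sigma\in S_{d-1}}(-1)^{\sigma}\{\{\{\ldots\{\{a_d,a_{\sigma(d-1)}\},a_{\sigma(d-2)}\},\ldots\},a_{\sigma(2)}\},a_{\sigma(1)}\},$$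 where $(-1)^\sigma$ is the sign of the permutation $\sigma$. *)

theory Defs
  imports
    Complex_Main
    "HOL-Library.Poly_Mapping"
    "HOL-Library.Function_Algebras"
    "HOL-Combinatorics.Permutations"
begin

section \<open>Commutative algebras and Lie algebras of derivations\<close>

text \<open>The class \<^class>\<open>comm_ring\<close> does not include a unit, so algebras are not assumed unital.\<close>

locale comm_algebra = vector_space scale
  for scale :: "'k::field \<Rightarrow> 'a::comm_ring \<Rightarrow> 'a" +
  assumes scale_mult_left: "scale c (x * y) = scale c x * y"

definition fun_scale :: "('k \<Rightarrow> 'a \<Rightarrow> 'a) \<Rightarrow> 'k \<Rightarrow> ('a \<Rightarrow> 'a) \<Rightarrow> ('a \<Rightarrow> 'a)" where
  "fun_scale scale c f = (\<lambda>x. scale c (f x))"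

definition commutator :: "('a \<Rightarrow> 'a) \<Rightarrow> ('a \<Rightarrow> 'a) \<Rightarrow> ('a \<Rightarrow> 'a::ab_group_add)" where
  "commutator f g = (f \<circ> g) - (g \<circ> f)"

definition derivations :: "('k::field \<Rightarrow> 'a::comm_ring \<Rightarrow> 'a) \<Rightarrow> ('a \<Rightarrow> 'a) set" where
  "derivations scale =
    {D. Vector_Spaces.linear scale scale D \<and> (\<forall>a b. D (a * b) = D a * b + a * D b)}"

definition lie_subalgebra_of_Der :: "('k::field \<Rightarrow> 'a::comm_ring \<Rightarrow> 'a) \<Rightarrow> ('a \<Rightarrow> 'a) set \<Rightarrow> bool" where
  "lie_subalgebra_of_Der scale L \<longleftrightarrow>
    L \<subseteq> derivations scale \<and> module.subspace (fun_scale scale) L \<and>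
    (\<forall>f\<in>L. \<forall>g\<in>L. commutator f g \<in> L)"

definition lie_generated :: "('k::field \<Rightarrow> 'a::comm_ring \<Rightarrow> 'a) \<Rightarrow> ('a \<Rightarrow> 'a) set \<Rightarrow> ('a \<Rightarrow> 'a) set" where
  "lie_generated scale S = lie_subalgebra_of_Der scale hull S"

definition finite_dimensional :: "('k::field \<Rightarrow> 'v::ab_group_add \<Rightarrow> 'v) \<Rightarrow> 'v set \<Rightarrow> bool" where
  "finite_dimensional sc V \<longleftrightarrow> (\<exists>B. finite B \<and> module.span sc B = V)"


section \<open>The universal enveloping algebra\<close>

text \<open>Words form the free monoid, written additively so that \<open>'x fword \<Rightarrow>\<^sub>0 'k\<close> carries the
  multiplication of the free associative unital algebra on \<open>'x\<close>.\<close>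

datatype 'x fword = FWord (letters: "'x list")

instantiation fword :: (type) monoid_add
begin

definition zero_fword :: "'a fword" where
  "zero_fword = FWord []"

definition plus_fword :: "'a fword \<Rightarrow> 'a fword \<Rightarrow> 'a fword" where
  "plus_fword u v = FWord (letters u @ letters v)"

instance
  by standard (simp_all add: zero_fword_def plus_fword_def)

end

definition free_algebra :: "'x set \<Rightarrow> ('x fword \<Rightarrow>\<^sub>0 'k::field) set" where
  "free_algebra X = {P. \<forall>w\<in>Poly_Mapping.keys P. set (letters w) \<subseteq> X}"

definition gen :: "'x \<Rightarrow> ('x fword \<Rightarrow>\<^sub>0 'k::field)" where
  "gen x = Poly_Mapping.single (FWord [x]) 1"

text \<open>The enveloping algebra of a Lie algebra \<open>L\<close> with scalar multiplication \<open>sc\<close> and bracket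
  \<open>br\<close> is the quotient of the tensor algebra of \<open>L\<close> by the relations \<open>xy - yx = [x,y]\<close>. The tensor
  algebra is in turn the quotient of the free algebra on the set \<open>L\<close> by the relations that make the
  inclusion of \<open>L\<close> linear; both kinds of relations are imposed at once.\<close>

definition env_relators ::
  "('k::field \<Rightarrow> 'l::ab_group_add \<Rightarrow> 'l) \<Rightarrow> ('l \<Rightarrow> 'l \<Rightarrow> 'l) \<Rightarrow> 'l set \<Rightarrow> ('l fword \<Rightarrow>\<^sub>0 'k) set" where
  "env_relators sc br L =
    {gen (x + y) - gen x - gen y | x y. x \<in> L \<and> y \<in> L} \<union>
    {gen (sc c x) - Poly_Mapping.single 0 c * gen x | c x. x \<in> L} \<union>
    {gen x * gen y - gen y * gen x - gen (br x y) | x y. x \<in> L \<and> y \<in> L}"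

inductive_set env_ideal ::
  "('k::field \<Rightarrow> 'l::ab_group_add \<Rightarrow> 'l) \<Rightarrow> ('l \<Rightarrow> 'l \<Rightarrow> 'l) \<Rightarrow> 'l set \<Rightarrow> ('l fword \<Rightarrow>\<^sub>0 'k) set"
  for sc br L where
  zero: "0 \<in> env_ideal sc br L"
| relator: "R \<in> env_relators sc br L \<Longrightarrow> R \<in> env_ideal sc br L"
| add: "P \<in> env_ideal sc br L \<Longrightarrow> Q \<in> env_ideal sc br L \<Longrightarrow> P + Q \<in> env_ideal sc br L"
| mult_left: "P \<in> env_ideal sc br L \<Longrightarrow> Q \<in> free_algebra L \<Longrightarrow> Q * P \<in> env_ideal sc br L"
| mult_right: "P \<in> env_ideal sc br L \<Longrightarrow> Q \<in> free_algebra L \<Longrightarrow> P * Q \<in> env_ideal sc br L"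

definition env_class ::
  "('k::field \<Rightarrow> 'l::ab_group_add \<Rightarrow> 'l) \<Rightarrow> ('l \<Rightarrow> 'l \<Rightarrow> 'l) \<Rightarrow> 'l set \<Rightarrow>
    ('l fword \<Rightarrow>\<^sub>0 'k) \<Rightarrow> ('l fword \<Rightarrow>\<^sub>0 'k) set" where
  "env_class sc br L P = (\<lambda>Q. P + Q) ` env_ideal sc br L"

definition env_algebra ::
  "('k::field \<Rightarrow> 'l::ab_group_add \<Rightarrow> 'l) \<Rightarrow> ('l \<Rightarrow> 'l \<Rightarrow> 'l) \<Rightarrow> 'l set \<Rightarrow> ('l fword \<Rightarrow>\<^sub>0 'k) set set" where
  "env_algebra sc br L = env_class sc br L ` free_algebra L"

definition env_filtration ::
  "('k::field \<Rightarrow> 'l::ab_group_add \<Rightarrow> 'l) \<Rightarrow> ('l \<Rightarrow> 'l \<Rightarrow> 'l) \<Rightarrow> 'l set \<Rightarrow> nat \<Rightarrow>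
    ('l fword \<Rightarrow>\<^sub>0 'k) set set" where
  "env_filtration sc br L k =
    env_class sc br L ` {P \<in> free_algebra L. \<forall>w\<in>Poly_Mapping.keys P. length (letters w) \<le> k}"

text \<open>The elements of the enveloping algebra of \<open>L\<close> that are linear combinations of products of
  elements of \<open>X \<subseteq> L\<close>.\<close>

definition env_combinations ::
  "('k::field \<Rightarrow> 'l::ab_group_add \<Rightarrow> 'l) \<Rightarrow> ('l \<Rightarrow> 'l \<Rightarrow> 'l) \<Rightarrow> 'l set \<Rightarrow> 'l set \<Rightarrow>
    ('l fword \<Rightarrow>\<^sub>0 'k) set set" where
  "env_combinations sc br L X = env_class sc br L ` free_algebra X"


section \<open>The action of the enveloping algebra of a Lie algebra of operators\<close>

definition word_act :: "('a \<Rightarrow> 'a) fword \<Rightarrow> 'a \<Rightarrow> 'a" where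
  "word_act w = foldr (\<circ>) (letters w) id"

definition free_act ::
  "('k::field \<Rightarrow> 'a::ab_group_add \<Rightarrow> 'a) \<Rightarrow> (('a \<Rightarrow> 'a) fword \<Rightarrow>\<^sub>0 'k) \<Rightarrow> 'a \<Rightarrow> 'a" where
  "free_act scale P a = (\<Sum>w\<in>Poly_Mapping.keys P. scale (Poly_Mapping.lookup P w) (word_act w a))"

text \<open>The choice of the representative is immaterial: see \<open>env_act_class\<close> below.\<close>

definition env_act ::
  "('k::field \<Rightarrow> 'a::ab_group_add \<Rightarrow> 'a) \<Rightarrow> (('a \<Rightarrow> 'a) fword \<Rightarrow>\<^sub>0 'k) set \<Rightarrow> 'a \<Rightarrow> 'a" where
  "env_act scale u = free_act scale (SOME P. P \<in> u)"

context vector_space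
begin

lemma free_act_superset:
  assumes "finite W" "Poly_Mapping.keys P \<subseteq> W"
  shows "free_act scale P a = (\<Sum>w\<in>W. scale (Poly_Mapping.lookup P w) (word_act w a))"
  unfolding free_act_def
  by (rule sum.mono_neutral_left) (use assms in \<open>auto simp: in_keys_iff\<close>)

lemma free_act_add: "free_act scale (P + Q) a = free_act scale P a + free_act scale Q a"
proof -
  let ?W = "Poly_Mapping.keys P \<union> Poly_Mapping.keys Q"
  have "free_act scale (P + Q) a =
      (\<Sum>w\<in>?W. scale (Poly_Mapping.lookup (P + Q) w) (word_act w a))"
    by (rule free_act_superset) (simp_all add: Poly_Mapping.keys_add)
  also have "\<dots> = (\<Sum>w\<in>?W. scale (Poly_Mapping.lookup P w) (word_act w a)) +
      (\<Sum>w\<in>?W. scale (Poly_Mapping.lookup Q w) (word_act w a))"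
    by (simp add: lookup_add scale_left_distrib sum.distrib)
  also have "\<dots> = free_act scale P a + free_act scale Q a"
    by (simp add: free_act_superset[of ?W P] free_act_superset[of ?W Q])
  finally show ?thesis .
qed

lemma free_act_zero [simp]: "free_act scale 0 a = 0"
  by (simp add: free_act_def)

lemma free_act_diff: "free_act scale (P - Q) a = free_act scale P a - free_act scale Q a"
  using free_act_add[of "P - Q" Q a] by (simp add: algebra_simps)

lemma free_act_sum: "free_act scale (sum f I) a = (\<Sum>i\<in>I. free_act scale (f i) a)"
  by (induction I rule: infinite_finite_induct) (simp_all add: free_act_add)

lemma free_act_single: "free_act scale (Poly_Mapping.single w c) a = scale c (word_act w a)"
  by (cases "c = 0") (simp_all add: free_act_def)

lemma free_act_gen [simp]: "free_act scale (gen x) = x"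
  by (rule ext) (simp add: gen_def free_act_single word_act_def)

lemma word_act_plus:
  fixes u v :: "('c \<Rightarrow> 'c) fword"
  shows "word_act (u + v) = word_act u \<circ> word_act v"
proof -
  have "foldr (\<circ>) xs h = foldr (\<circ>) xs id \<circ> h" for xs :: "('c \<Rightarrow> 'c) list" and h
    by (induction xs) (auto simp: comp_assoc)
  from this[of "letters u" "foldr (\<circ>) (letters v) id"] show ?thesis
    by (simp add: word_act_def plus_fword_def)
qed

lemma word_act_linear:
  assumes "\<And>f. f \<in> L \<Longrightarrow> Vector_Spaces.linear scale scale f" "set (letters w) \<subseteq> L"
  shows "Vector_Spaces.linear scale scale (word_act w)"
proof -
  have "Vector_Spaces.linear scale scale (foldr (\<circ>) fs id)" if "set fs \<subseteq> L" for fs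
    using that
    by (induction fs) (auto intro: linear_id Vector_Spaces.linear_compose assms(1))
  then show ?thesis using assms(2) by (simp add: word_act_def)
qed

lemma free_act_mult:
  assumes lin: "\<And>f. f \<in> L \<Longrightarrow> Vector_Spaces.linear scale scale f" and P: "P \<in> free_algebra L"
  shows "free_act scale (P * Q) a = free_act scale P (free_act scale Q a)"
proof -
  have expand: "R = (\<Sum>w\<in>Poly_Mapping.keys R. Poly_Mapping.single w (Poly_Mapping.lookup R w))"
    for R :: "('b \<Rightarrow> 'b) fword \<Rightarrow>\<^sub>0 'a"
    by (rule poly_mapping_eqI) (auto simp: lookup_sum lookup_single when_def in_keys_iff)
  have "free_act scale (P * Q) a =
      (\<Sum>w\<in>Poly_Mapping.keys P. \<Sum>v\<in>Poly_Mapping.keys Q.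
        scale (Poly_Mapping.lookup P w * Poly_Mapping.lookup Q v) (word_act w (word_act v a)))"
    by (subst expand[of P], subst expand[of Q])
      (simp add: sum_product mult_single free_act_sum free_act_single word_act_plus)
  also have "\<dots> = (\<Sum>w\<in>Poly_Mapping.keys P.
      scale (Poly_Mapping.lookup P w) (word_act w (free_act scale Q a)))"
  proof (rule sum.cong[OF refl])
    fix w assume "w \<in> Poly_Mapping.keys P"
    then have "set (letters w) \<subseteq> L"
      using P by (auto simp: free_algebra_def)
    then interpret w: Vector_Spaces.linear scale scale "word_act w"
      using word_act_linear lin by blast
    show "(\<Sum>v\<in>Poly_Mapping.keys Q.
        scale (Poly_Mapping.lookup P w * Poly_Mapping.lookup Q v) (word_act w (word_act v a))) =
      scale (Poly_Mapping.lookup P w) (word_act w (free_act scale Q a))"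
      by (simp add: free_act_def w.sum w.scale scale_sum_right)
  qed
  also have "\<dots> = free_act scale P (free_act scale Q a)"
    by (simp add: free_act_def)
  finally show ?thesis .
qed

lemma free_act_zero_right:
  assumes lin: "\<And>f. f \<in> L \<Longrightarrow> Vector_Spaces.linear scale scale f" and P: "P \<in> free_algebra L"
  shows "free_act scale P 0 = 0"
  using free_act_mult[OF lin P, of 0 0] by simp

lemma free_act_relator:
  assumes lin: "\<And>f. f \<in> L \<Longrightarrow> Vector_Spaces.linear scale scale f"
    and R: "R \<in> env_relators (fun_scale scale) commutator L"
  shows "free_act scale R a = 0"
proof -
  have gen: "gen x \<in> free_algebra L" if "x \<in> L" for x
    using that by (simp add: gen_def free_algebra_def)
  have const: "Poly_Mapping.single 0 c \<in> free_algebra L" for c :: 'a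
    by (simp add: free_algebra_def zero_fword_def)
  have word_zero: "word_act 0 = id"
    by (simp add: word_act_def zero_fword_def)
  show ?thesis
    using R unfolding env_relators_def
    by (auto simp: free_act_diff free_act_mult[OF lin gen] free_act_mult[OF lin const]
        free_act_single fun_scale_def commutator_def word_zero)
qed

lemma free_act_ideal:
  assumes lin: "\<And>f. f \<in> L \<Longrightarrow> Vector_Spaces.linear scale scale f"
    and closed: "\<And>x y. x \<in> L \<Longrightarrow> y \<in> L \<Longrightarrow> x + y \<in> L"
      "\<And>c x. x \<in> L \<Longrightarrow> fun_scale scale c x \<in> L"
      "\<And>x y. x \<in> L \<Longrightarrow> y \<in> L \<Longrightarrow> commutator x y \<in> L"
    and P: "P \<in> env_ideal (fun_scale scale) commutator L"
  shows "free_act scale P a = 0"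
proof -
  have gen: "gen x \<in> free_algebra L" if "x \<in> L" for x
    using that by (simp add: gen_def free_algebra_def)
  have const: "Poly_Mapping.single 0 c \<in> free_algebra L" for c :: 'a
    by (simp add: free_algebra_def zero_fword_def)
  have diff: "Q - R \<in> free_algebra L" if "Q \<in> free_algebra L" "R \<in> free_algebra L" for Q R
    using that keys_diff[of Q R] by (fastforce simp: free_algebra_def)
  have plus: "Q + R \<in> free_algebra L" if "Q \<in> free_algebra L" "R \<in> free_algebra L" for Q R
    using that Poly_Mapping.keys_add[of Q R] by (fastforce simp: free_algebra_def)
  have mult: "Q * R \<in> free_algebra L" if "Q \<in> free_algebra L" "R \<in> free_algebra L" for Q R
    using that keys_mult[of Q R] by (fastforce simp: free_algebra_def plus_fword_def)
  have "P \<in> free_algebra L \<and> (\<forall>a. free_act scale P a = 0)"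
    using P
  proof induction
    case zero
    then show ?case by (simp add: free_algebra_def)
  next
    case (relator R)
    then have "R \<in> free_algebra L"
      by (auto simp: env_relators_def intro!: diff mult gen const closed)
    with relator show ?case using free_act_relator[OF lin] by blast
  next
    case (add P Q)
    then show ?case
      by (simp add: free_act_add plus)
  next
    case (mult_left P Q)
    then show ?case
      by (auto simp: mult free_act_mult[OF lin] free_act_zero_right[OF lin])
  next
    case (mult_right P Q)
    then show ?case
      by (auto simp: mult free_act_mult[OF lin])
  qed
  then show ?thesis by blast
qed

end

lemma env_act_class:
  assumes "comm_algebra scale" and L: "lie_subalgebra_of_Der scale L"
  shows "env_act scale (env_class (fun_scale scale) commutator L P) = free_act scale P"
proof
  fix a
  interpret comm_algebra scale by fact
  interpret fs: vector_space "fun_scale scale"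
    by unfold_locales (auto simp: fun_scale_def algebra_simps)
  let ?u = "env_class (fun_scale scale) commutator L P"
  have "P \<in> ?u"
    by (auto simp: env_class_def intro!: image_eqI[of _ _ 0] env_ideal.zero)
  then have "(SOME Q. Q \<in> ?u) \<in> ?u" by (rule someI)
  then obtain Q where Q: "Q \<in> env_ideal (fun_scale scale) commutator L"
    and eq: "(SOME Q. Q \<in> ?u) = P + Q"
    by (auto simp: env_class_def)
  have "free_act scale Q a = 0"
    by (rule free_act_ideal[OF _ _ _ _ Q])
      (use L in \<open>auto simp: lie_subalgebra_of_Der_def derivations_def fs.subspace_def\<close>)
  then show "env_act scale ?u a = free_act scale P a"
    by (simp add: env_act_def eq free_act_add)
qed


section \<open>Derived operations and standard polynomials\<close>

definition derived_operation ::
  "('k::field \<Rightarrow> 'a::comm_ring \<Rightarrow> 'a) \<Rightarrow> nat \<Rightarrow> (nat \<Rightarrow> (('a \<Rightarrow> 'a) fword \<Rightarrow>\<^sub>0 'k) set) \<Rightarrow>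
    (nat \<Rightarrow> (('a \<Rightarrow> 'a) fword \<Rightarrow>\<^sub>0 'k) set) \<Rightarrow> 'a \<Rightarrow> 'a \<Rightarrow> 'a" where
  "derived_operation scale s f g a b = (\<Sum>j=1..s. env_act scale (f j) a * env_act scale (g j) b)"

text \<open>The order of a derived operation with respect to filtration degrees \<open>\<nu> j\<close> of \<open>f j\<close> and
  \<open>\<mu> j\<close> of \<open>g j\<close>; the inserted 0 only matters for the empty sum.\<close>

definition lie_order :: "nat \<Rightarrow> (nat \<Rightarrow> nat) \<Rightarrow> (nat \<Rightarrow> nat) \<Rightarrow> nat" where
  "lie_order s \<nu> \<mu> = Max (insert 0 ((\<lambda>j. \<nu> j + \<mu> j) ` {1..s}))"

text \<open>Both polynomials depend on \<open>a 1, \<dots>, a d\<close> only. Note that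
  \<open>foldr h [1..<d] z = h 1 (h 2 (\<dots> (h (d - 1) z)))\<close>.\<close>

definition standard_left ::
  "('k::field \<Rightarrow> 'a::comm_ring \<Rightarrow> 'a) \<Rightarrow> ('a \<Rightarrow> 'a \<Rightarrow> 'a) \<Rightarrow> nat \<Rightarrow> (nat \<Rightarrow> 'a) \<Rightarrow> 'a" where
  "standard_left scale br d a =
    (\<Sum>\<sigma> | \<sigma> permutes {1..<d}.
      scale (of_int (sign \<sigma>)) (foldr (\<lambda>i x. br (a (\<sigma> i)) x) [1..<d] (a d)))"

definition standard_right ::
  "('k::field \<Rightarrow> 'a::comm_ring \<Rightarrow> 'a) \<Rightarrow> ('a \<Rightarrow> 'a \<Rightarrow> 'a) \<Rightarrow> nat \<Rightarrow> (nat \<Rightarrow> 'a) \<Rightarrow> 'a" where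
  "standard_right scale br d a =
    (\<Sum>\<sigma> | \<sigma> permutes {1..<d}.
      scale (of_int (sign \<sigma>)) (foldr (\<lambda>i x. br x (a (\<sigma> i))) [1..<d] (a d)))"

definition standard_identity ::
  "('k::field \<Rightarrow> 'a::comm_ring \<Rightarrow> 'a) \<Rightarrow> ('a \<Rightarrow> 'a \<Rightarrow> 'a) \<Rightarrow> nat \<Rightarrow> bool" where
  "standard_identity scale br d \<longleftrightarrow>
    (\<forall>a. standard_left scale br d a = 0 \<and> standard_right scale br d a = 0)"

end

theory Submission
  imports Defs
begin

text \<open>
  Let \<open>e\<close> enumerate a spanning set of \<open>\<gg>\<close> with \<open>N\<close> elements. Modulo operators of smaller order the
  \<open>e i\<close> commute, so every operator of order at most \<open>k\<close> is a combination of ordered monomials of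
  degree at most \<open>k\<close> in them (the easy half of the Poincare--Birkhoff--Witt theorem). By the Leibniz
  rule, a \<open>(d - 1)\<close>-fold nested bracket is a combination of products \<open>M\<^sub>1 (a 1) \<cdots> M\<^sub>d (a d)\<close> of
  ordered monomials of total degree at most \<open>m (d - 1)\<close>. Alternating over \<open>a 1, \<dots>, a (d - 1)\<close> kills
  each product in which two of \<open>M\<^sub>1, \<dots>, M\<^sub>d\<^sub>-\<^sub>1\<close> coincide. If they are distinct and
  \<open>d - 1 = (N + p choose N)\<close>, the number of ordered monomials of degree at most \<open>p\<close>, then their
  total degree is at least that of all these monomials together, which is
  \<open>(d - 1) p N / (N + 1) > m (d - 1)\<close>. The right identity is the left one for the opposite
  operation.
\<close>

section \<open>Sorted lists over a finite alphabet\<close>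

definition sorted_lists :: "'i::linorder set \<Rightarrow> 'i list set" where
  "sorted_lists A = {w \<in> lists A. sorted w}"

definition sorted_lists_upto :: "'i::linorder set \<Rightarrow> nat \<Rightarrow> 'i list set" where
  "sorted_lists_upto A k = {w \<in> sorted_lists A. length w \<le> k}"

lemma finite_sorted_lists_upto:
  assumes "finite A"
  shows "finite (sorted_lists_upto A k)"
  by (rule finite_subset[OF _ finite_lists_length_le[OF assms, of k]])
    (auto simp: sorted_lists_upto_def sorted_lists_def)

lemma sorted_lists_upto_empty [simp]: "sorted_lists_upto {} k = {[]}"
  by (auto simp: sorted_lists_upto_def sorted_lists_def)

lemma sorted_lists_upto_0 [simp]: "sorted_lists_upto A 0 = {[]}"
  by (auto simp: sorted_lists_upto_def sorted_lists_def)

lemma sorted_lists_upto_insert_max: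
  assumes "\<forall>a\<in>A. a < b"
  shows "sorted_lists_upto (insert b A) (Suc k) =
    sorted_lists_upto A (Suc k) \<union> (\<lambda>w. w @ [b]) ` sorted_lists_upto (insert b A) k"
    (is "?lhs = ?rhs")
proof
  show "?lhs \<subseteq> ?rhs"
  proof
    fix w assume w: "w \<in> ?lhs"
    show "w \<in> ?rhs"
    proof (cases "b \<in> set w")
      case False
      then show ?thesis using w by (auto simp: sorted_lists_upto_def sorted_lists_def)
    next
      case True
      then obtain v x where v: "w = v @ [x]" by (cases w rule: rev_cases) auto
      then have "x = b"
        using True w assms
        by (fastforce simp: sorted_lists_upto_def sorted_lists_def sorted_append)
      then show ?thesis
        using w v by (auto simp: sorted_lists_upto_def sorted_lists_def sorted_append)
    qed
  qed
  show "?rhs \<subseteq> ?lhs"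
    using assms
    by (fastforce simp: sorted_lists_upto_def sorted_lists_def sorted_append)
qed

lemma sum_sorted_lists_upto_insert_max:
  assumes "finite A" "\<forall>a\<in>A. a < b"
  shows "sum h (sorted_lists_upto (insert b A) (Suc k)) =
    sum h (sorted_lists_upto A (Suc k)) + (\<Sum>w\<in>sorted_lists_upto (insert b A) k. h (w @ [b]))"
proof -
  let ?append = "\<lambda>w. w @ [b]"
  have "sorted_lists_upto A (Suc k) \<inter> ?append ` sorted_lists_upto (insert b A) k = {}"
    using assms(2) by (auto simp: sorted_lists_upto_def sorted_lists_def)
  moreover have "inj_on ?append (sorted_lists_upto (insert b A) k)"
    by (simp add: inj_on_def)
  ultimately show ?thesis
    using assms(1)
    by (simp add: sorted_lists_upto_insert_max[OF assms(2)] finite_sorted_lists_upto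
        sum.union_disjoint sum.reindex)
qed

lemma card_sorted_lists_upto:
  assumes "finite A"
  shows "card (sorted_lists_upto A k) = (card A + k) choose card A"
  using assms
proof (induction A arbitrary: k rule: finite_linorder_max_induct)
  case empty
  show ?case by simp
next
  case (insert b A)
  then have card: "card (insert b A) = Suc (card A)" by (subst card_insert_disjoint) auto
  show ?case
  proof (induction k)
    case 0
    show ?case by simp
  next
    case (Suc k)
    show ?case
      using sum_sorted_lists_upto_insert_max[OF insert(1,2), of "\<lambda>_. 1 :: nat" k] insert(3) Suc
      by (simp add: card)
  qed
qed

lemma sum_length_sorted_lists_upto:
  assumes "finite A"
  shows "(\<Sum>w\<in>sorted_lists_upto A k. length w) = card A * ((card A + k) choose Suc (card A))"
  using assms
proof (induction A arbitrary: k rule: finite_linorder_max_induct)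
  case empty
  show ?case by simp
next
  case (insert b A)
  then have card: "card (insert b A) = Suc (card A)" by (subst card_insert_disjoint) auto
  show ?case
  proof (induction k)
    case 0
    show ?case by (simp add: card)
  next
    case (Suc k)
    have "(\<Sum>w\<in>sorted_lists_upto (insert b A) (Suc k). length w) =
        card A * ((card A + Suc k) choose Suc (card A)) +
        (Suc (card A) * (Suc (card A + k) choose Suc (Suc (card A))) +
          (Suc (card A + k) choose Suc (card A)))"
      using sum_sorted_lists_upto_insert_max[OF insert(1,2), of length k] insert Suc
        card_sorted_lists_upto[of "insert b A" k]
      by (simp add: card sum_Suc)
    then show ?case by (simp add: card algebra_simps)
  qed
qed

lemma sum_le_sum_if_sublevel:
  fixes f :: "'a \<Rightarrow> 'b::{semiring_1, ordered_comm_monoid_add}"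
  assumes "finite S" "finite T" "card T = card S"
    and below: "\<And>x. x \<in> T \<Longrightarrow> f x \<le> p" and above: "\<And>x. x \<in> S - T \<Longrightarrow> p \<le> f x"
  shows "sum f T \<le> sum f S"
proof -
  have "card (T - S) = card (S - T)"
    using assms(1-3) by (intro antisym card_le_sym_Diff) simp_all
  then have "sum f (T - S) \<le> of_nat (card (S - T)) * p"
    using sum_bounded_above[of "T - S" f p] below by simp
  also have "\<dots> \<le> sum f (S - T)"
    using above by (rule sum_bounded_below)
  finally have "sum f (T \<inter> S) + sum f (T - S) \<le> sum f (S \<inter> T) + sum f (S - T)"
    by (simp only: Int_commute[of T] add_left_mono)
  then show ?thesis
    by (simp only: sum.Int_Diff[OF assms(1), of f T] sum.Int_Diff[OF assms(2), of f S])
qed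

lemma sum_length_sorted_lists_gt:
  assumes "finite A" and S: "S \<subseteq> sorted_lists A" "card S = (card A + p) choose card A"
    and p: "m * Suc (card A) < p * card A"
  shows "m * card S < (\<Sum>w\<in>S. length w)"
proof -
  let ?N = "card A"
  have pos: "card S > 0" by (simp add: S(2))
  then have "finite S" by (rule card_ge_0_finite)
  have "?N * ((?N + p) choose Suc ?N) = (\<Sum>w\<in>sorted_lists_upto A p. length w)"
    by (simp add: sum_length_sorted_lists_upto[OF assms(1)])
  also have "\<dots> \<le> (\<Sum>w\<in>S. length w)"
    by (rule sum_le_sum_if_sublevel[where p = p])
      (use \<open>finite S\<close> S finite_sorted_lists_upto[OF assms(1), of p]
          card_sorted_lists_upto[OF assms(1), of p] in \<open>auto simp: sorted_lists_upto_def\<close>)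
  finally have total: "?N * ((?N + p) choose Suc ?N) \<le> (\<Sum>w\<in>S. length w)" .
  have absorb: "Suc ?N * ((?N + p) choose Suc ?N) = p * card S"
    using binomial_absorb_comp[of "?N + p" ?N] binomial_absorption[of ?N "?N + p"]
    by (simp only: add_diff_cancel_left' S(2))
  have "Suc ?N * (m * card S) = m * Suc ?N * card S"
    by (simp add: algebra_simps)
  also have "\<dots> < p * ?N * card S"
    using p pos by (rule mult_less_mono1)
  also have "\<dots> = ?N * (p * card S)"
    by (simp add: ac_simps)
  also have "\<dots> = Suc ?N * (?N * ((?N + p) choose Suc ?N))"
    unfolding absorb[symmetric] by (rule mult.left_commute)
  also have "\<dots> \<le> Suc ?N * (\<Sum>w\<in>S. length w)"
    using total by (rule mult_le_mono2)
  finally show ?thesis by (simp only: mult_less_cancel1)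
qed


section \<open>Alternation\<close>

definition alternation ::
  "('k::field \<Rightarrow> 'v::ab_group_add \<Rightarrow> 'v) \<Rightarrow> 'i set \<Rightarrow> (('i \<Rightarrow> 'c) \<Rightarrow> 'v) \<Rightarrow> ('i \<Rightarrow> 'c) \<Rightarrow> 'v" where
  "alternation scale I F a = (\<Sum>\<sigma> | \<sigma> permutes I. scale (of_int (sign \<sigma>)) (F (a \<circ> \<sigma>)))"

lemma (in vector_space) alternation_eq_0_if_symmetric:
  assumes "finite I" "i \<in> I" "j \<in> I" "i \<noteq> j"
    and symmetric: "\<And>b. F (b \<circ> transpose i j) = F b"
  shows "alternation scale I F a = 0"
  unfolding alternation_def
proof (rule sum_involution_eq_0[where h = "\<lambda>\<sigma>. \<sigma> \<circ> transpose i j"])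
  have transpose: "transpose i j permutes I"
    using assms(2,3) by (rule permutes_swap_id)
  fix \<sigma> assume "\<sigma> \<in> {\<sigma>. \<sigma> permutes I}"
  then have \<sigma>: "\<sigma> permutes I" by simp
  then show "\<sigma> \<circ> transpose i j \<in> {\<sigma>. \<sigma> permutes I}"
    using permutes_compose[OF transpose] by simp
  have "sign (\<sigma> \<circ> transpose i j) = - sign \<sigma>"
    using \<sigma> assms(1,4) transpose
    by (simp add: sign_compose sign_swap_id permutes_imp_permutation)
  then show "scale (of_int (sign (\<sigma> \<circ> transpose i j))) (F (a \<circ> (\<sigma> \<circ> transpose i j))) +
      scale (of_int (sign \<sigma>)) (F (a \<circ> \<sigma>)) = 0"
    by (simp add: symmetric flip: comp_assoc)
  show "\<sigma> \<circ> transpose i j \<circ> transpose i j = \<sigma>"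
    by (simp add: comp_assoc)
  show "\<sigma> \<circ> transpose i j \<noteq> \<sigma>"
    using assms(4) permutes_inj[OF \<sigma>] by (metis comp_apply injD transpose_apply_first)
qed

lemma standard_left_eq_alternation:
  "standard_left scale br d a =
    alternation scale {1..<d} (\<lambda>a. foldr (\<lambda>i. br (a i)) [1..<d] (a d)) a"
  unfolding standard_left_def alternation_def
  by (intro sum.cong refl) (simp add: permutes_not_in)

lemma standard_right_eq_standard_left:
  "standard_right scale br d a = standard_left scale (\<lambda>x y. br y x) d a"
  by (simp add: standard_left_def standard_right_def)


section \<open>Linear maps and spans\<close>

lemma linear_span_mem:
  assumes "Vector_Spaces.linear s1 s2 f" "module.subspace s2 V" "\<And>x. x \<in> X \<Longrightarrow> f x \<in> V"
    and "x \<in> module.span s1 X"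
  shows "f x \<in> V"
proof -
  interpret Vector_Spaces.linear s1 s2 f by fact
  have "vs1.span X \<subseteq> f -` V"
    using assms(2,3) by (intro vs1.span_minimal subspace_vimage) auto
  then show ?thesis using assms(4) by auto
qed

lemma bilinear_span_mem:
  assumes "\<And>y. Vector_Spaces.linear s1 s3 (\<lambda>x. h x y)"
    and "\<And>x. x \<in> X \<Longrightarrow> Vector_Spaces.linear s2 s3 (h x)"
    and "module.subspace s3 V" "\<And>x y. x \<in> X \<Longrightarrow> y \<in> Y \<Longrightarrow> h x y \<in> V"
    and "x \<in> module.span s1 X" "y \<in> module.span s2 Y"
  shows "h x y \<in> V"
proof (rule linear_span_mem[OF assms(1,3) _ assms(5)])
  fix x assume "x \<in> X"
  then show "h x y \<in> V"
    using assms(4) by (intro linear_span_mem[OF assms(2) assms(3) _ assms(6)])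
qed

definition pointwise_scale :: "('k \<Rightarrow> 'v \<Rightarrow> 'v) \<Rightarrow> 'k \<Rightarrow> ('c \<Rightarrow> 'v) \<Rightarrow> 'c \<Rightarrow> 'v" where
  "pointwise_scale scale c F = (\<lambda>a. scale c (F a))"

context vector_space
begin

lemma vector_space_pointwise_scale: "vector_space (pointwise_scale scale)"
  by unfold_locales (simp_all add: pointwise_scale_def fun_eq_iff scale_right_distrib
      scale_left_distrib)

lemma vector_space_fun_scale: "vector_space (fun_scale scale)"
  using vector_space_pointwise_scale
  by (simp add: fun_scale_def[abs_def] pointwise_scale_def[abs_def])

lemma linear_alternation:
  "Vector_Spaces.linear (pointwise_scale scale) (pointwise_scale scale) (alternation scale I)"
  by (simp add: Vector_Spaces.linear_iff vector_space_pointwise_scale fun_eq_iff alternation_def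
      pointwise_scale_def scale_right_distrib sum.distrib scale_sum_right mult.commute)

end


section \<open>Lie algebras of operators\<close>

definition comp_list :: "('v \<Rightarrow> 'v) list \<Rightarrow> 'v \<Rightarrow> 'v" where
  "comp_list xs = foldr (\<circ>) xs id"

lemma comp_list_Nil [simp]: "comp_list [] = id"
  and comp_list_Cons [simp]: "comp_list (x # xs) = x \<circ> comp_list xs"
  by (simp_all add: comp_list_def)

definition monomial :: "('i \<Rightarrow> 'v \<Rightarrow> 'v) \<Rightarrow> 'i list \<Rightarrow> 'v \<Rightarrow> 'v" where
  "monomial e w = comp_list (map e w)"

lemma monomial_Nil [simp]: "monomial e [] = id"
  and monomial_Cons [simp]: "monomial e (i # w) = e i \<circ> monomial e w"
  by (simp_all add: monomial_def)

locale operator_lie_algebra = vector_space scale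
  for scale :: "'k::field \<Rightarrow> 'v::ab_group_add \<Rightarrow> 'v" +
  fixes L :: "('v \<Rightarrow> 'v) set"
  assumes linear_if_mem: "x \<in> L \<Longrightarrow> Vector_Spaces.linear scale scale x"
    and subspace_L: "module.subspace (fun_scale scale) L"
    and commutator_mem: "x \<in> L \<Longrightarrow> y \<in> L \<Longrightarrow> commutator x y \<in> L"
begin

sublocale operators: vector_space "fun_scale scale"
  by (rule vector_space_fun_scale)

lemma linear_comp_left:
  assumes "x \<in> L"
  shows "Vector_Spaces.linear (fun_scale scale) (fun_scale scale) ((\<circ>) x)"
proof -
  interpret x: Vector_Spaces.linear scale scale x
    using assms by (rule linear_if_mem)
  show ?thesis
    by (simp add: Vector_Spaces.linear_iff operators.vector_space_axioms fun_eq_iff fun_scale_def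
        x.add x.scale)
qed

lemma linear_comp_right:
  "Vector_Spaces.linear (fun_scale scale) (fun_scale scale) (\<lambda>x. x \<circ> u)"
  by (simp add: Vector_Spaces.linear_iff operators.vector_space_axioms fun_eq_iff fun_scale_def)

text \<open>The image of \<open>F\<^sup>k U(L)\<close> in the algebra of operators.\<close>

definition op_filtration :: "nat \<Rightarrow> ('v \<Rightarrow> 'v) set" where
  "op_filtration k = operators.span (comp_list ` {xs \<in> lists L. length xs \<le> k})"

lemma subspace_op_filtration: "operators.subspace (op_filtration k)"
  unfolding op_filtration_def by (rule operators.subspace_span)

lemma zero_mem_op_filtration: "0 \<in> op_filtration k"
  using subspace_op_filtration by (rule operators.subspace_0)

lemma op_filtration_mono: "k \<le> l \<Longrightarrow> op_filtration k \<subseteq> op_filtration l"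
  unfolding op_filtration_def by (intro operators.span_mono image_mono) auto

lemma comp_list_mem_op_filtration:
  "xs \<in> lists L \<Longrightarrow> length xs \<le> k \<Longrightarrow> comp_list xs \<in> op_filtration k"
  unfolding op_filtration_def by (intro operators.span_base imageI) simp

lemma monomial_mem_op_filtration:
  assumes "e ` A \<subseteq> L" "w \<in> lists A" "length w \<le> k"
  shows "monomial e w \<in> op_filtration k"
  unfolding monomial_def
  using assms by (intro comp_list_mem_op_filtration) (auto simp: in_lists_conv_set image_subset_iff)

lemma comp_mem_op_filtration_Suc:
  assumes x: "x \<in> L" and u: "u \<in> op_filtration k"
  shows "x \<circ> u \<in> op_filtration (Suc k)"
proof (rule linear_span_mem[OF linear_comp_left[OF x] subspace_op_filtration
      _ u[unfolded op_filtration_def]])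
  fix v assume "v \<in> comp_list ` {xs \<in> lists L. length xs \<le> k}"
  then show "x \<circ> v \<in> op_filtration (Suc k)"
    using x comp_list_mem_op_filtration[of "x # _" "Suc k"] by auto
qed

lemma monomial_insort_mem_op_filtration:
  assumes letters: "e ` A \<subseteq> L" and i: "i \<in> A" and w: "w \<in> lists A"
  shows "(e i \<circ> monomial e w) - monomial e (insort i w) \<in> op_filtration (length w)"
  using w
proof (induction w)
  case Nil
  show ?case using zero_mem_op_filtration by (simp add: zero_fun_def)
next
  case (Cons j w)
  show ?case
  proof (cases "i \<le> j")
    case True
    then show ?thesis using zero_mem_op_filtration by (simp add: zero_fun_def)
  next
    case False
    have mem: "e i \<in> L" "e j \<in> L" using letters i Cons by auto
    interpret e_j: Vector_Spaces.linear scale scale "e j"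
      using mem(2) by (rule linear_if_mem)
    have "monomial e w \<in> op_filtration (length w)"
      using letters Cons.hyps(2) by (rule monomial_mem_op_filtration) simp
    then have "commutator (e i) (e j) \<circ> monomial e w \<in> op_filtration (Suc (length w))"
      using mem by (intro comp_mem_op_filtration_Suc commutator_mem)
    moreover have "e j \<circ> ((e i \<circ> monomial e w) - monomial e (insort i w))
        \<in> op_filtration (Suc (length w))"
      using mem(2) Cons by (intro comp_mem_op_filtration_Suc)
    moreover have "(e i \<circ> monomial e (j # w)) - monomial e (insort i (j # w)) =
        (commutator (e i) (e j) \<circ> monomial e w) +
        (e j \<circ> ((e i \<circ> monomial e w) - monomial e (insort i w)))"
      using False by (simp add: fun_eq_iff commutator_def e_j.diff)
    ultimately show ?thesis
      by (simp only: list.size add_Suc_right add_0_right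
          operators.subspace_add[OF subspace_op_filtration])
  qed
qed

lemma monomial_sort_mem_op_filtration:
  assumes letters: "e ` A \<subseteq> L" and w: "w \<in> lists A" "length w \<le> Suc k"
  shows "monomial e w - monomial e (sort w) \<in> op_filtration k"
  using w
proof (induction w arbitrary: k)
  case Nil
  show ?case using zero_mem_op_filtration by (simp add: zero_fun_def)
next
  case (Cons i w)
  have i: "i \<in> A" "e i \<in> L" using letters Cons by auto
  interpret e_i: Vector_Spaces.linear scale scale "e i"
    using i(2) by (rule linear_if_mem)
  have "e i \<circ> (monomial e w - monomial e (sort w)) \<in> op_filtration k"
  proof (cases k)
    case 0
    then have "e i \<circ> (monomial e w - monomial e (sort w)) = 0"
      using Cons.prems by (simp add: fun_eq_iff)
    then show ?thesis by (simp only: zero_mem_op_filtration)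
  next
    case (Suc l)
    then have "monomial e w - monomial e (sort w) \<in> op_filtration l"
      using Cons.prems by (intro Cons.IH) simp
    then show ?thesis
      unfolding Suc using i(2) by (intro comp_mem_op_filtration_Suc)
  qed
  moreover have "(e i \<circ> monomial e (sort w)) - monomial e (insort i (sort w)) \<in> op_filtration k"
    using monomial_insort_mem_op_filtration[OF letters i(1), of "sort w"] Cons.prems
      op_filtration_mono[of "length w" k] Cons.hyps(2) by (auto simp: in_lists_conv_set)
  moreover have "monomial e (i # w) - monomial e (sort (i # w)) =
      (e i \<circ> (monomial e w - monomial e (sort w))) +
      ((e i \<circ> monomial e (sort w)) - monomial e (insort i (sort w)))"
    by (simp add: fun_eq_iff e_i.diff)
  ultimately show ?case
    by (simp only: operators.subspace_add[OF subspace_op_filtration])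
qed

lemma comp_list_mem_span_lists:
  assumes span: "operators.span (e ` A) = L" and "xs \<in> lists L" "length xs \<le> k"
  shows "comp_list xs \<in> operators.span (monomial e ` {w \<in> lists A. length w \<le> k})"
    (is "_ \<in> operators.span (monomial e ` ?W k)")
  using assms(2,3)
proof (induction xs arbitrary: k)
  case Nil
  have "monomial e [] \<in> operators.span (monomial e ` ?W k)"
    by (intro operators.span_base imageI) simp
  then show ?case by (simp only: monomial_Nil comp_list_Nil)
next
  case (Cons x xs)
  then obtain l where k: "k = Suc l" "comp_list xs \<in> operators.span (monomial e ` ?W l)"
    by (cases k) auto
  have "x \<circ> comp_list xs \<in> operators.span (monomial e ` ?W k)"
  proof (rule bilinear_span_mem[OF linear_comp_right linear_comp_left
        operators.subspace_span _ _ k(2)])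
    show "x \<in> operators.span (e ` A)" unfolding span by (rule Cons.hyps(1))
    show "y \<in> L" if "y \<in> e ` A" for y
      using operators.span_base[OF that] span by simp
    show "y \<circ> u \<in> operators.span (monomial e ` ?W k)" if "y \<in> e ` A" "u \<in> monomial e ` ?W l" for y u
    proof -
      obtain i w where "y = e i" "i \<in> A" "u = monomial e w" "w \<in> lists A" "length w \<le> l"
        using \<open>y \<in> e ` A\<close> \<open>u \<in> _\<close> by blast
      then show ?thesis
        using k(1) by (intro operators.span_base image_eqI[of _ _ "i # w"]) (simp_all add: comp_def)
    qed
  qed
  then show ?case by (simp only: comp_list_Cons)
qed

lemma op_filtration_eq_span_lists:
  assumes span: "operators.span (e ` A) = L"
  shows "op_filtration k = operators.span (monomial e ` {w \<in> lists A. length w \<le> k})"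
    (is "_ = ?S")
proof
  show "op_filtration k \<subseteq> ?S"
    unfolding op_filtration_def
    using comp_list_mem_span_lists[OF span]
    by (intro operators.span_minimal operators.subspace_span) auto
  have "e ` A \<subseteq> L"
    using span operators.span_superset by blast
  then show "?S \<subseteq> op_filtration k"
    by (intro operators.span_minimal subspace_op_filtration)
      (auto intro: monomial_mem_op_filtration)
qed

theorem op_filtration_eq_span_sorted_lists:
  assumes span: "operators.span (e ` A) = L"
  shows "op_filtration k = operators.span (monomial e ` sorted_lists_upto A k)"
    (is "_ = ?S k")
proof
  have letters: "e ` A \<subseteq> L"
    using span operators.span_superset by blast
  show "op_filtration k \<subseteq> ?S k"
  proof (induction k)
    case 0
    show ?case
      unfolding op_filtration_eq_span_lists[OF span]
      by (intro operators.span_mono) auto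
  next
    case (Suc k)
    have "monomial e w \<in> ?S (Suc k)" if w: "w \<in> lists A" "length w \<le> Suc k" for w
    proof -
      have "?S k \<subseteq> ?S (Suc k)"
        by (intro operators.span_mono) (auto simp: sorted_lists_upto_def)
      then have "monomial e w - monomial e (sort w) \<in> ?S (Suc k)"
        using monomial_sort_mem_op_filtration[OF letters w] Suc by blast
      moreover have "monomial e (sort w) \<in> ?S (Suc k)"
        by (intro operators.span_base imageI)
          (use w in \<open>auto simp: sorted_lists_upto_def sorted_lists_def\<close>)
      ultimately show ?thesis
        using operators.span_add by fastforce
    qed
    then show ?case
      unfolding op_filtration_eq_span_lists[OF span]
      by (intro operators.span_minimal operators.subspace_span) auto
  qed
  show "?S k \<subseteq> op_filtration k"
    unfolding op_filtration_eq_span_lists[OF span]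
    by (intro operators.span_mono) (auto simp: sorted_lists_upto_def sorted_lists_def)
qed

end


section \<open>Multidifferential operators\<close>

text \<open>Without a unit there is no empty product, so one factor \<open>z\<close> is singled out.\<close>

definition seeded_prod :: "('i \<Rightarrow> 'a::ab_semigroup_mult) \<Rightarrow> 'a \<Rightarrow> 'i set \<Rightarrow> 'a" where
  "seeded_prod c z I = Finite_Set.fold (\<lambda>i. (*) (c i)) z I"

lemma comp_fun_commute_times:
  fixes c :: "'i \<Rightarrow> 'a::ab_semigroup_mult"
  shows "comp_fun_commute (\<lambda>i. (*) (c i))"
  by standard (simp add: fun_eq_iff mult.left_commute)

lemma seeded_prod_empty [simp]: "seeded_prod c z {} = z"
  by (simp add: seeded_prod_def)

lemma seeded_prod_insert [simp]:
  assumes "finite I" "i \<notin> I"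
  shows "seeded_prod c z (insert i I) = c i * seeded_prod c z I"
proof -
  interpret comp_fun_commute "\<lambda>i. (*) (c i)" by (rule comp_fun_commute_times)
  show ?thesis unfolding seeded_prod_def using assms by (rule fold_insert)
qed

lemma seeded_prod_cong:
  assumes "finite I" "\<And>i. i \<in> I \<Longrightarrow> c i = c' i" "z = z'"
  shows "seeded_prod c z I = seeded_prod c' z' I"
  using assms by (induction I) simp_all

lemma seeded_prod_permute:
  assumes "\<pi> permutes I"
  shows "seeded_prod (c \<circ> \<pi>) z I = seeded_prod c z I"
proof -
  have "Finite_Set.fold (\<lambda>i. (*) (c i)) z (\<pi> ` I) = Finite_Set.fold (\<lambda>i. (*) (c (\<pi> i))) z I"
    using fold_image[OF permutes_inj_on[OF assms], of "\<lambda>i. (*) (c i)" z] by (simp add: comp_def)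
  then show ?thesis
    by (simp add: seeded_prod_def permutes_image[OF assms])
qed

definition monomial_product ::
  "('i \<Rightarrow> 'a \<Rightarrow> 'a::ab_semigroup_mult) \<Rightarrow> 'j \<Rightarrow> 'j set \<Rightarrow> ('j \<Rightarrow> 'i list) \<Rightarrow> ('j \<Rightarrow> 'a) \<Rightarrow> 'a" where
  "monomial_product e d I ws a =
    seeded_prod (\<lambda>i. monomial e (ws i) (a i)) (monomial e (ws d) (a d)) I"

lemma monomial_product_insert:
  assumes "finite I" "i \<notin> insert d I"
  shows "monomial_product e d (insert i I) (ws(i := w)) a =
    monomial e w (a i) * monomial_product e d I ws a"
proof -
  have "monomial_product e d (insert i I) (ws(i := w)) a =
      monomial e w (a i) * monomial_product e d I (ws(i := w)) a"
    using assms by (simp add: monomial_product_def)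
  also have "monomial_product e d I (ws(i := w)) a = monomial_product e d I ws a"
    unfolding monomial_product_def using assms by (intro seeded_prod_cong) auto
  finally show ?thesis .
qed

lemma monomial_product_transpose:
  assumes "d \<notin> I" "i \<in> I" "j \<in> I" "ws i = ws j"
  shows "monomial_product e d I ws (a \<circ> transpose i j) = monomial_product e d I ws a"
proof -
  let ?c = "\<lambda>l. monomial e (ws l) (a l)"
  have "ws (transpose i j l) = ws l" for l
    using assms(4) by (simp add: transpose_def)
  moreover have "transpose i j d = d"
    using assms(1-3) by (intro transpose_apply_other) auto
  ultimately have "monomial_product e d I ws (a \<circ> transpose i j) =
      seeded_prod (?c \<circ> transpose i j) (monomial e (ws d) (a d)) I"
    by (simp add: monomial_product_def comp_def)
  also have "\<dots> = monomial_product e d I ws a"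
    unfolding monomial_product_def
    using permutes_swap_id[OF assms(2,3)] by (rule seeded_prod_permute)
  finally show ?thesis .
qed

lemma (in comm_algebra) scale_mult_right: "scale c (x * y) = x * scale c y"
  by (metis mult.commute scale_mult_left)

locale derivation_lie_algebra = comm_algebra scale
  for scale :: "'k::field \<Rightarrow> 'a::comm_ring \<Rightarrow> 'a" +
  fixes L :: "('a \<Rightarrow> 'a) set"
  assumes lie_subalgebra: "lie_subalgebra_of_Der scale L"
begin

sublocale operator_lie_algebra scale L
  using vector_space_axioms lie_subalgebra
  by (auto simp: operator_lie_algebra_def operator_lie_algebra_axioms_def
      lie_subalgebra_of_Der_def derivations_def)

sublocale multi: vector_space "pointwise_scale scale :: 'k \<Rightarrow> ((nat \<Rightarrow> 'a) \<Rightarrow> 'a) \<Rightarrow> _"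
  by (rule vector_space_pointwise_scale)

lemma leibniz: "x \<in> L \<Longrightarrow> x (a * b) = x a * b + a * x b"
  using lie_subalgebra by (auto simp: lie_subalgebra_of_Der_def derivations_def)

lemma linear_apply:
  "Vector_Spaces.linear (fun_scale scale) (pointwise_scale scale) (\<lambda>u (a :: nat \<Rightarrow> 'a). u (F a))"
  by (simp add: Vector_Spaces.linear_iff operators.vector_space_axioms multi.vector_space_axioms
      fun_eq_iff fun_scale_def pointwise_scale_def)

lemma linear_apply_times:
  "Vector_Spaces.linear (fun_scale scale) (pointwise_scale scale)
    (\<lambda>u (a :: nat \<Rightarrow> 'a). u (a i) * F a)"
  by (simp add: Vector_Spaces.linear_iff operators.vector_space_axioms multi.vector_space_axioms
      fun_eq_iff fun_scale_def pointwise_scale_def distrib_right scale_mult_left)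

lemma linear_times:
  "Vector_Spaces.linear (pointwise_scale scale) (pointwise_scale scale)
    (\<lambda>F (a :: nat \<Rightarrow> 'a). h a * F a)"
  by (simp add: Vector_Spaces.linear_iff multi.vector_space_axioms
      fun_eq_iff pointwise_scale_def distrib_left scale_mult_right)

lemma linear_derivation_comp:
  assumes "x \<in> L"
  shows "Vector_Spaces.linear (pointwise_scale scale) (pointwise_scale scale)
    (\<lambda>F (a :: nat \<Rightarrow> 'a). x (F a))"
proof -
  interpret x: Vector_Spaces.linear scale scale x
    using assms by (rule linear_if_mem)
  show ?thesis
    by (simp add: Vector_Spaces.linear_iff multi.vector_space_axioms
        fun_eq_iff pointwise_scale_def x.add x.scale)
qed

primrec multidiff :: "nat \<Rightarrow> nat list \<Rightarrow> nat \<Rightarrow> ((nat \<Rightarrow> 'a) \<Rightarrow> 'a) set" where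
  "multidiff d [] k = (\<lambda>u a. u (a d)) ` op_filtration k"
| "multidiff d (i # is) k = multi.span
    {\<lambda>a. u (a i) * F a | u F p q. u \<in> op_filtration p \<and> F \<in> multidiff d is q \<and> p + q \<le> k}"

lemma subspace_multidiff: "multi.subspace (multidiff d is k)"
proof (cases "is")
  case Nil
  interpret Vector_Spaces.linear "fun_scale scale" "pointwise_scale scale"
    "\<lambda>u (a :: nat \<Rightarrow> 'a). u (a d)"
    by (rule linear_apply)
  show ?thesis
    using subspace_image[OF subspace_op_filtration] by (simp add: Nil)
next
  case Cons
  then show ?thesis by (simp add: multi.subspace_span)
qed

lemma multidiff_Cons_mem:
  assumes "u \<in> op_filtration p" "F \<in> multidiff d is q" "p + q \<le> k"
  shows "(\<lambda>a. u (a i) * F a) \<in> multidiff d (i # is) k"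
  unfolding multidiff.simps using assms by (intro multi.span_base) blast

lemma multidiff_mono:
  assumes "k \<le> l"
  shows "multidiff d is k \<subseteq> multidiff d is l"
proof (cases "is")
  case Nil
  then show ?thesis using op_filtration_mono[OF assms] by auto
next
  case Cons
  show ?thesis
    unfolding Cons multidiff.simps
    by (rule multi.span_mono) (use assms in \<open>blast intro: order_trans\<close>)
qed

lemma derivation_comp_mem_multidiff:
  assumes "x \<in> L" "F \<in> multidiff d is k"
  shows "(\<lambda>a. x (F a)) \<in> multidiff d is (Suc k)"
  using assms(2)
proof (induction "is" arbitrary: F k)
  case Nil
  then obtain u where "F = (\<lambda>a. u (a d))" "u \<in> op_filtration k" by auto
  then have "(\<lambda>a. x (F a)) = (\<lambda>a. (x \<circ> u) (a d))" "x \<circ> u \<in> op_filtration (Suc k)"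
    using comp_mem_op_filtration_Suc[OF assms(1)] by simp_all
  then show ?case by (simp only: multidiff.simps image_eqI)
next
  case (Cons i "is")
  show ?case
  proof (rule linear_span_mem[OF linear_derivation_comp[OF assms(1)] subspace_multidiff
        _ Cons.prems[unfolded multidiff.simps]])
    fix G
    assume "G \<in> {\<lambda>a. u (a i) * F a | u F p q.
      u \<in> op_filtration p \<and> F \<in> multidiff d is q \<and> p + q \<le> k}"
    then obtain u H p q where G: "G = (\<lambda>a. u (a i) * H a)" "u \<in> op_filtration p"
      "H \<in> multidiff d is q" "p + q \<le> k" by blast
    have "(\<lambda>a. (x \<circ> u) (a i) * H a) \<in> multidiff d (i # is) (Suc k)"
      by (rule multidiff_Cons_mem[OF comp_mem_op_filtration_Suc]) (use assms(1) G in auto)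
    moreover have "(\<lambda>a. u (a i) * x (H a)) \<in> multidiff d (i # is) (Suc k)"
      by (rule multidiff_Cons_mem[OF _ Cons.IH]) (use G in auto)
    moreover have "(\<lambda>a. x (G a)) =
        (\<lambda>a. (x \<circ> u) (a i) * H a) + (\<lambda>a. u (a i) * x (H a))"
      by (simp add: G(1) fun_eq_iff leibniz[OF assms(1)])
    ultimately show "(\<lambda>a. x (G a)) \<in> multidiff d (i # is) (Suc k)"
      by (simp only: multi.subspace_add[OF subspace_multidiff])
  qed
qed

lemma op_filtration_comp_mem_multidiff:
  assumes "u \<in> op_filtration l" and F: "F \<in> multidiff d is k"
  shows "(\<lambda>a. u (F a)) \<in> multidiff d is (l + k)"
proof (rule linear_span_mem[OF linear_apply subspace_multidiff
      _ assms(1)[unfolded op_filtration_def]])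
  have "(\<lambda>a. comp_list xs (F a)) \<in> multidiff d is (length xs + k)" if "xs \<in> lists L" for xs
    using that by (induction xs) (auto intro: F derivation_comp_mem_multidiff)
  then show "(\<lambda>a. v (F a)) \<in> multidiff d is (l + k)"
    if "v \<in> comp_list ` {xs \<in> lists L. length xs \<le> l}" for v
    using that multidiff_mono[of "length _ + k" "l + k"] by fastforce
qed

inductive bidifferential :: "nat \<Rightarrow> ('a \<Rightarrow> 'a \<Rightarrow> 'a) \<Rightarrow> bool" for m where
  zero: "bidifferential m (\<lambda>x y. 0)"
| add: "bidifferential m br \<Longrightarrow> bidifferential m br' \<Longrightarrow> bidifferential m (\<lambda>x y. br x y + br' x y)"
| product: "u \<in> op_filtration p \<Longrightarrow> v \<in> op_filtration q \<Longrightarrow> p + q \<le> m \<Longrightarrow>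
    bidifferential m (\<lambda>x y. u x * v y)"

lemma bidifferential_flip:
  "bidifferential m br \<Longrightarrow> bidifferential m (\<lambda>x y. br y x)"
proof (induction rule: bidifferential.induct)
  case (product u p v q)
  then have "bidifferential m (\<lambda>x y. v x * u y)"
    by (intro bidifferential.product[of v q u p]) simp_all
  then show ?case by (simp add: mult.commute)
qed (simp_all add: bidifferential.intros)

lemma bidifferential_sum:
  "(\<And>j. j \<in> J \<Longrightarrow> bidifferential m (br j)) \<Longrightarrow> bidifferential m (\<lambda>x y. \<Sum>j\<in>J. br j x y)"
  by (induction J rule: infinite_finite_induct) (simp_all add: bidifferential.intros)

lemma bidifferential_mem_multidiff:
  assumes "bidifferential m br" and F: "F \<in> multidiff d is k"
  shows "(\<lambda>a. br (a i) (F a)) \<in> multidiff d (i # is) (m + k)"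
  using assms(1)
proof (induction rule: bidifferential.induct)
  case zero
  then show ?case
    using multi.subspace_0[OF subspace_multidiff] by (simp only: zero_fun_def)
next
  case (add br br')
  then show ?case
    using multi.subspace_add[OF subspace_multidiff] by (simp only: plus_fun_def)
next
  case (product u p v q)
  show ?case
    by (rule multidiff_Cons_mem[OF _ op_filtration_comp_mem_multidiff[OF _ F]])
      (use product in auto)
qed

lemma foldr_bidifferential_mem_multidiff:
  assumes "bidifferential m br"
  shows "(\<lambda>a. foldr (\<lambda>i. br (a i)) is (a d)) \<in> multidiff d is (m * length is)"
proof (induction "is")
  case Nil
  have "id \<in> op_filtration 0"
    using comp_list_mem_op_filtration[of "[]" 0] by simp
  then show ?case by (auto intro!: image_eqI[of _ _ id])
next
  case (Cons i "is")
  then show ?case using bidifferential_mem_multidiff[OF assms Cons] by simp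
qed


subsection \<open>Expansion into products of ordered monomials\<close>

definition monomial_products ::
  "('i::linorder \<Rightarrow> 'a \<Rightarrow> 'a) \<Rightarrow> 'i set \<Rightarrow> nat \<Rightarrow> nat set \<Rightarrow> nat \<Rightarrow> ((nat \<Rightarrow> 'a) \<Rightarrow> 'a) set" where
  "monomial_products e A d I k =
    {monomial_product e d I ws | ws.
      ws ` insert d I \<subseteq> sorted_lists A \<and> (\<Sum>i\<in>insert d I. length (ws i)) \<le> k}"

lemma monomial_times_mem_monomial_products:
  assumes "finite I" and i: "i \<notin> insert d I"
    and w: "w \<in> sorted_lists_upto A p" and F: "F \<in> monomial_products e A d I q" and "p + q \<le> k"
  shows "(\<lambda>a. monomial e w (a i) * F a) \<in> monomial_products e A d (insert i I) k"
proof -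
  obtain ws where F_eq: "F = monomial_product e d I ws"
    and ws: "ws ` insert d I \<subseteq> sorted_lists A" "(\<Sum>i\<in>insert d I. length (ws i)) \<le> q"
    using F by (auto simp: monomial_products_def)
  let ?ws = "ws(i := w)"
  have "(\<lambda>a. monomial e w (a i) * F a) = monomial_product e d (insert i I) ?ws"
    using assms(1) i by (simp add: fun_eq_iff F_eq monomial_product_insert)
  moreover have "(\<Sum>j\<in>insert d (insert i I). length (?ws j)) \<le> k"
  proof -
    have "(\<Sum>j\<in>insert d I. length (?ws j)) = (\<Sum>j\<in>insert d I. length (ws j))"
      using i by (intro sum.cong) auto
    then show ?thesis
      using assms(1,5) i w ws(2) by (simp add: insert_commute[of d] sorted_lists_upto_def)
  qed
  moreover have "?ws ` insert d (insert i I) \<subseteq> sorted_lists A"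
    using w ws(1) by (auto simp: sorted_lists_upto_def)
  ultimately show ?thesis
    unfolding monomial_products_def by (intro CollectI exI[of _ ?ws] conjI)
qed

lemma multidiff_subset_span_monomial_products:
  assumes span: "operators.span (e ` A) = L" and "distinct is" "d \<notin> set is"
  shows "multidiff d is k \<subseteq> multi.span (monomial_products e A d (set is) k)"
  using assms(2,3)
proof (induction "is" arbitrary: k)
  case Nil
  have "(\<lambda>a. u (a d)) \<in> multi.span (monomial_products e A d {} k)" if "u \<in> op_filtration k" for u
  proof (rule linear_span_mem[OF linear_apply multi.subspace_span
        _ that[unfolded op_filtration_eq_span_sorted_lists[OF span]]])
    fix v assume "v \<in> monomial e ` sorted_lists_upto A k"
    then obtain w where "v = monomial e w" "w \<in> sorted_lists_upto A k" by auto
    then have "(\<lambda>a. v (a d)) \<in> monomial_products e A d {} k"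
      by (auto simp: monomial_products_def monomial_product_def sorted_lists_upto_def
          intro!: exI[of _ "\<lambda>_. w"])
    then show "(\<lambda>a. v (a d)) \<in> multi.span (monomial_products e A d {} k)"
      by (rule multi.span_base)
  qed
  then show ?case by auto
next
  case (Cons i "is")
  have "(\<lambda>a. u (a i) * F a) \<in> multi.span (monomial_products e A d (insert i (set is)) k)"
    if u: "u \<in> op_filtration p" and F: "F \<in> multidiff d is q" and "p + q \<le> k" for u F p q
  proof (rule bilinear_span_mem[OF linear_apply_times linear_times multi.subspace_span
        _ u[unfolded op_filtration_eq_span_sorted_lists[OF span]]])
    show "F \<in> multi.span (monomial_products e A d (set is) q)"
      using Cons F by auto
    show "(\<lambda>a. v (a i) * G a) \<in> multi.span (monomial_products e A d (insert i (set is)) k)"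
      if "v \<in> monomial e ` sorted_lists_upto A p" "G \<in> monomial_products e A d (set is) q" for v G
      using that Cons.prems \<open>p + q \<le> k\<close>
      by (auto intro!: multi.span_base monomial_times_mem_monomial_products)
  qed
  then show ?case
    unfolding multidiff.simps by (intro multi.span_minimal multi.subspace_span) auto
qed

lemma alternation_monomial_products_eq_0:
  assumes "finite A" "finite I" "d \<notin> I" and card: "card I = (card A + p) choose card A"
    and p: "m * Suc (card A) < p * card A"
    and F: "F \<in> monomial_products e A d I (m * card I)"
  shows "alternation scale I F a = 0"
proof -
  obtain ws where F_eq: "F = monomial_product e d I ws"
    and ws: "ws ` insert d I \<subseteq> sorted_lists A" "(\<Sum>i\<in>insert d I. length (ws i)) \<le> m * card I"
    using F by (auto simp: monomial_products_def)
  have "\<not> inj_on ws I"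
  proof
    assume inj: "inj_on ws I"
    have "m * card (ws ` I) < (\<Sum>w\<in>ws ` I. length w)"
      using assms(1) by (rule sum_length_sorted_lists_gt[OF _ _ _ p])
        (use ws(1) card in \<open>auto simp: card_image[OF inj]\<close>)
    also have "\<dots> = (\<Sum>i\<in>I. length (ws i))" by (simp add: sum.reindex[OF inj])
    also have "\<dots> \<le> m * card I" using ws(2) assms(2,3) by simp
    finally show False by (simp add: card_image[OF inj])
  qed
  then obtain i j where ij: "i \<in> I" "j \<in> I" "i \<noteq> j" "ws i = ws j"
    by (auto simp: inj_on_def)
  then have "F (b \<circ> transpose i j) = F b" for b
    unfolding F_eq using assms(3) by (intro monomial_product_transpose)
  then show ?thesis
    using assms(2) ij(1-3) by (intro alternation_eq_0_if_symmetric)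
qed

lemma alternation_multidiff_eq_0:
  fixes e :: "'i::linorder \<Rightarrow> 'a \<Rightarrow> 'a"
  assumes "operators.span (e ` A) = L" "finite A" and "is": "distinct is" "d \<notin> set is"
    and len: "length is = (card A + p) choose card A" and p: "m * Suc (card A) < p * card A"
    and F: "F \<in> multidiff d is (m * length is)"
  shows "alternation scale (set is) F = 0"
proof -
  have "F \<in> multi.span (monomial_products e A d (set is) (m * card (set is)))"
    using multidiff_subset_span_monomial_products[OF assms(1) "is"] F
    by (auto simp: distinct_card[OF "is"(1)])
  from linear_span_mem[OF linear_alternation multi.subspace_single_0 _ this, of "set is"]
  show ?thesis
    using alternation_monomial_products_eq_0[OF assms(2) _ "is"(2) _ p] len
    by (auto simp: fun_eq_iff distinct_card[OF "is"(1)])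
qed

lemma standard_left_bidifferential_eq_0:
  fixes e :: "'i::linorder \<Rightarrow> 'a \<Rightarrow> 'a"
  assumes "operators.span (e ` A) = L" "finite A" and p: "m * Suc (card A) < p * card A"
    and br: "bidifferential m br"
  shows "standard_left scale br (1 + ((card A + p) choose card A)) a = 0"
proof -
  let ?d = "1 + ((card A + p) choose card A)"
  let ?F = "\<lambda>a. foldr (\<lambda>i. br (a i)) [1..<?d] (a ?d)"
  have "alternation scale (set [1..<?d]) ?F = 0"
    by (rule alternation_multidiff_eq_0[OF assms(1,2) _ _ _ p
          foldr_bidifferential_mem_multidiff[OF br]]) (simp_all add: Suc_le_eq)
  then show ?thesis
    by (simp only: standard_left_eq_alternation set_upt zero_fun_apply)
qed

theorem standard_identity_bidifferential:
  assumes "finite B" "operators.span B = L" and p: "m * Suc (card B) < p * card B"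
    and br: "bidifferential m br"
  shows "standard_identity scale br (1 + ((card B + p) choose card B))"
proof -
  obtain e where "bij_betw e {..<card B} B"
    using ex_bij_betw_nat_finite[OF assms(1)] by (auto simp: atLeast0LessThan)
  then have span: "operators.span (e ` {..<card B}) = L"
    using assms(2) by (simp add: bij_betw_def)
  show ?thesis
    unfolding standard_identity_def standard_right_eq_standard_left
    using standard_left_bidifferential_eq_0[OF span _ _ br, of p]
      standard_left_bidifferential_eq_0[OF span _ _ bidifferential_flip[OF br], of p] p
    by simp
qed

lemma ex_standard_identity_bidifferential:
  assumes "finite_dimensional (fun_scale scale) L" "bidifferential m br"
  shows "\<exists>d>0. standard_identity scale br d"
proof -
  obtain B where B: "finite B" "operators.span B = L"
    using assms(1) by (auto simp: finite_dimensional_def)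
  \<comment> \<open>Adding 0 to the spanning set makes it nonempty, which covers the case \<open>L = 0\<close>.\<close>
  let ?B = "insert 0 B"
  have "card ?B > 0" using B(1) by (simp add: card_gt_0_iff)
  then have "m * Suc (card ?B) < (2 * m + 1) * card ?B"
    by (cases "card ?B") simp_all
  then have "standard_identity scale br (1 + ((card ?B + (2 * m + 1)) choose card ?B))"
    using B assms(2) by (intro standard_identity_bidifferential) simp_all
  then show ?thesis by (intro exI conjI) simp_all
qed

lemma standard_identity_bidifferential_dim:
  assumes N: "N = operators.dim L" "N \<ge> 1" and p: "real p > real m * (1 + 1 / real N)"
    and br: "bidifferential m br"
  shows "standard_identity scale br (1 + ((N + p) choose N))"
proof -
  obtain B where B: "B \<subseteq> L" "L \<subseteq> operators.span B" "card B = N"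
    using operators.basis_exists[of L] N(1) by metis
  then have "finite B" using N(2) by (intro card_ge_0_finite) simp
  moreover have "operators.span B = L"
    using B(1,2) operators.span_minimal[OF B(1) subspace_L] by blast
  moreover have "m * Suc N < p * N"
  proof -
    have "real (m * Suc N) < real (p * N)"
      using p N(2) by (simp add: field_simps)
    then show ?thesis by (simp only: of_nat_less_iff)
  qed
  ultimately show ?thesis
    using standard_identity_bidifferential[OF _ _ _ br, of B p] B(3) by simp
qed

end


section \<open>Derived operations\<close>

lemma env_combinations_subset_env_filtration:
  assumes "X \<subseteq> L"
  shows "env_combinations sc br L X \<subseteq> (\<Union>k. env_filtration sc br L k)"
proof
  fix u assume "u \<in> env_combinations sc br L X"
  then obtain P where P: "u = env_class sc br L P" "P \<in> free_algebra X"
    by (auto simp: env_combinations_def)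
  have "length (letters w) \<le> Max ((\<lambda>w. length (letters w)) ` Poly_Mapping.keys P)"
    if "w \<in> Poly_Mapping.keys P" for w
    using that by (intro Max_ge) auto
  moreover have "P \<in> free_algebra L" using P(2) assms by (auto simp: free_algebra_def)
  ultimately show "u \<in> (\<Union>k. env_filtration sc br L k)"
    unfolding env_filtration_def P(1) by blast
qed

context derivation_lie_algebra
begin

lemma env_act_mem_op_filtration:
  assumes "u \<in> env_filtration (fun_scale scale) commutator L k"
  shows "env_act scale u \<in> op_filtration k"
proof -
  obtain P where P: "u = env_class (fun_scale scale) commutator L P" "P \<in> free_algebra L"
    "\<And>w. w \<in> Poly_Mapping.keys P \<Longrightarrow> length (letters w) \<le> k"
    using assms by (auto simp: env_filtration_def)
  have "env_act scale u = free_act scale P"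
    unfolding P(1) using comm_algebra_axioms lie_subalgebra by (rule env_act_class)
  also have "\<dots> = (\<Sum>w\<in>Poly_Mapping.keys P.
      fun_scale scale (Poly_Mapping.lookup P w) (comp_list (letters w)))"
  proof
    fix a
    have "(\<Sum>w\<in>W. h w) a = (\<Sum>w\<in>W. h w a)" for W and h :: "('a \<Rightarrow> 'a) fword \<Rightarrow> 'a \<Rightarrow> 'a"
      by (induction W rule: infinite_finite_induct) simp_all
    then show "free_act scale P a = (\<Sum>w\<in>Poly_Mapping.keys P.
        fun_scale scale (Poly_Mapping.lookup P w) (comp_list (letters w))) a"
      by (simp add: free_act_def fun_scale_def word_act_def comp_list_def)
  qed
  also have "\<dots> \<in> op_filtration k"
    using P(2,3)
    by (intro operators.subspace_sum operators.subspace_scale subspace_op_filtration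
        comp_list_mem_op_filtration) (auto simp: free_algebra_def)
  finally show ?thesis .
qed

lemma bidifferential_derived_operation:
  assumes "\<forall>j\<in>{1..s}. f j \<in> env_filtration (fun_scale scale) commutator L (\<nu> j) \<and>
    g j \<in> env_filtration (fun_scale scale) commutator L (\<mu> j)"
  shows "bidifferential (lie_order s \<nu> \<mu>) (derived_operation scale s f g)"
proof -
  have "bidifferential (lie_order s \<nu> \<mu>) (\<lambda>x y. env_act scale (f j) x * env_act scale (g j) y)"
    if "j \<in> {1..s}" for j
  proof (rule bidifferential.product)
    show "env_act scale (f j) \<in> op_filtration (\<nu> j)" "env_act scale (g j) \<in> op_filtration (\<mu> j)"
      using assms that by (auto intro: env_act_mem_op_filtration)
    show "\<nu> j + \<mu> j \<le> lie_order s \<nu> \<mu>"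
      unfolding lie_order_def using that by (intro Max_ge) auto
  qed
  from bidifferential_sum[OF this] show ?thesis
    by (simp only: derived_operation_def[abs_def])
qed

lemma ex_bidifferential_derived_operation:
  assumes "X \<subseteq> L"
    and "\<And>j. j \<in> {1..s} \<Longrightarrow> f j \<in> env_combinations (fun_scale scale) commutator L X"
    and "\<And>j. j \<in> {1..s} \<Longrightarrow> g j \<in> env_combinations (fun_scale scale) commutator L X"
  shows "\<exists>m. bidifferential m (derived_operation scale s f g)"
proof -
  have "\<forall>j\<in>{1..s}. \<exists>k. f j \<in> env_filtration (fun_scale scale) commutator L k"
    "\<forall>j\<in>{1..s}. \<exists>k. g j \<in> env_filtration (fun_scale scale) commutator L k"
    using env_combinations_subset_env_filtration[OF assms(1)] assms(2,3) by blast+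
  then obtain \<nu> \<mu> where
    "\<forall>j\<in>{1..s}. f j \<in> env_filtration (fun_scale scale) commutator L (\<nu> j) \<and>
      g j \<in> env_filtration (fun_scale scale) commutator L (\<mu> j)"
    by metis
  then show ?thesis by (blast dest: bidifferential_derived_operation)
qed

end


section \<open>Generated Lie algebras of derivations\<close>

context comm_algebra
begin

lemma mem_derivations_iff:
  "D \<in> derivations scale \<longleftrightarrow> (\<forall>a b. D (a + b) = D a + D b) \<and>
    (\<forall>c a. D (scale c a) = scale c (D a)) \<and> (\<forall>a b. D (a * b) = D a * b + a * D b)"
  using vector_space_axioms by (auto simp: derivations_def Vector_Spaces.linear_iff)

lemma commutator_derivations:
  assumes "D \<in> derivations scale" "E \<in> derivations scale"
  shows "commutator D E \<in> derivations scale"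
proof -
  interpret D: Vector_Spaces.linear scale scale D
    using assms(1) by (simp add: derivations_def)
  interpret E: Vector_Spaces.linear scale scale E
    using assms(2) by (simp add: derivations_def)
  show ?thesis
    using assms
    by (simp add: mem_derivations_iff commutator_def D.diff E.diff scale_right_diff_distrib
        algebra_simps)
qed

lemma subspace_derivations: "module.subspace (fun_scale scale) (derivations scale)"
proof -
  interpret operators: vector_space "fun_scale scale"
    by (rule vector_space_fun_scale)
  show ?thesis
    by (rule operators.subspaceI)
      (simp_all add: mem_derivations_iff fun_scale_def algebra_simps
        flip: scale_mult_left scale_mult_right)
qed

lemma lie_subalgebra_lie_generated:
  assumes "S \<subseteq> derivations scale"
  shows "lie_subalgebra_of_Der scale (lie_generated scale S)"
proof -
  interpret operators: vector_space "fun_scale scale"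
    by (rule vector_space_fun_scale)
  have "lie_subalgebra_of_Der scale (derivations scale)"
    by (simp add: lie_subalgebra_of_Der_def subspace_derivations commutator_derivations)
  then have "lie_generated scale S \<subseteq> derivations scale"
    unfolding lie_generated_def using assms by (intro hull_minimal)
  then show ?thesis
    unfolding lie_generated_def hull_def lie_subalgebra_of_Der_def operators.subspace_def by auto
qed

end

theorem theorem3:
  fixes scale :: "'k::field \<Rightarrow> 'a::comm_ring \<Rightarrow> 'a"
    and n :: nat and D :: "nat \<Rightarrow> 'a \<Rightarrow> 'a"
    and \<gg> :: "('a \<Rightarrow> 'a) set"
    and s :: nat and f g :: "nat \<Rightarrow> (('a \<Rightarrow> 'a) fword \<Rightarrow>\<^sub>0 'k) set"
  assumes "comm_algebra scale"
    and "\<And>i. i \<in> {1..n} \<Longrightarrow> D i \<in> derivations scale"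
    and "\<gg> = lie_generated scale (D ` {1..n})"
    and "finite_dimensional (fun_scale scale) \<gg>"
    and "\<And>j. j \<in> {1..s} \<Longrightarrow>
           f j \<in> env_combinations (fun_scale scale) commutator \<gg> (D ` {1..n})"
    and "\<And>j. j \<in> {1..s} \<Longrightarrow>
           g j \<in> env_combinations (fun_scale scale) commutator \<gg> (D ` {1..n})"
  shows "(\<exists>d>0. standard_identity scale (derived_operation scale s f g) d) \<and>
    (\<forall>N m p :: nat. \<forall>\<nu> \<mu> :: nat \<Rightarrow> nat.
      N = vector_space.dim (fun_scale scale) \<gg> \<longrightarrow> N \<ge> 1 \<longrightarrow>
      (\<forall>j\<in>{1..s}. f j \<in> env_filtration (fun_scale scale) commutator \<gg> (\<nu> j) \<and>
                   g j \<in> env_filtration (fun_scale scale) commutator \<gg> (\<mu> j)) \<longrightarrow>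
      m = lie_order s \<nu> \<mu> \<longrightarrow>
      real p > real m * (1 + 1 / real N) \<longrightarrow>
      standard_identity scale (derived_operation scale s f g) (1 + ((N + p) choose N)))"
proof -
  interpret comm_algebra scale by fact
  have "D ` {1..n} \<subseteq> derivations scale" using assms(2) by auto
  then interpret derivation_lie_algebra scale \<gg>
    unfolding assms(3) by unfold_locales (rule lie_subalgebra_lie_generated)
  have "D ` {1..n} \<subseteq> \<gg>"
    unfolding assms(3) lie_generated_def by (rule hull_subset)
  then have "\<exists>m. bidifferential m (derived_operation scale s f g)"
    using assms(5,6) by (rule ex_bidifferential_derived_operation)
  then have "\<exists>d>0. standard_identity scale (derived_operation scale s f g) d"
    using ex_standard_identity_bidifferential[OF assms(4)] by blast
  moreover have "standard_identity scale (derived_operation scale s f g) (1 + ((N + p) choose N))"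
    if "N = operators.dim \<gg>" "N \<ge> 1" and p: "real p > real (lie_order s \<nu> \<mu>) * (1 + 1 / real N)"
      and fg: "\<forall>j\<in>{1..s}. f j \<in> env_filtration (fun_scale scale) commutator \<gg> (\<nu> j) \<and>
        g j \<in> env_filtration (fun_scale scale) commutator \<gg> (\<mu> j)" for N p \<nu> \<mu>
    using that(1,2) p bidifferential_derived_operation[OF fg]
    by (rule standard_identity_bidifferential_dim)
  ultimately show ?thesis by simp
qed

end
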